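(* Let $P=(p_1,p_2,\ldots)$ be a sequence of prime numbers such that the set $S(P)$ is nonempty and finite. Let $k\in\mathbb{N}$ be given. If $k$ is a multiple of the product of all prime numbers from $S(P)$, then the identity $e$ of the $P$-adic solenoid $\Sigma_P$ is the only periodic point of the limit mapping $h^k_P:\Sigma_P\to\Sigma_P$. If there exists a prime number from $S(P)$ which is not a divisor of $k$, then the set of all periodic points of the limit mapping $h^k_P$ is dense in $\Sigma_P$.
   Context: $\mathbb{N}$ is the set of positive integers; $1$ is not a prime. $\mathbb{S}^1$ is the unit circle in $\mathbb{C}$. For a sequence $P=(p_1,p_2,\ldots)$ of prime numbers, the $P$-adic solenoid is the inverse limit $\Sigma_P=\{(z_1,z_2,\ldots)\in\prod_{n\ge 1}\mathbb{S}^1 : z_{n+1}^{p_n}=z_n \text{ for all } n\in\mathbb{N}\}$ with the topology induced from the product topology; it is a compact abelian group under coordinatewise multiplication with identity $e=(1,1,\ldots)$. For $k\in\mathbb{N}$ the limit mapping $h^k_P:\Sigma_P\to\Sigma_P$ is $h^k_P((z_1,z_2,\ldots))=(z_1^k,z_2^k,\ldots)$. $S(P)$ denotes the set of all prime numbers which do not occur infinitely often in $P$, i.e. primes $q$ for which there is $m\in\mathbb{N}$ with $q\ne p_n$ for all $n\ge m$. A point $x\in X$ is periodic for a mapping $f:X\to X$ if there exists $n\in\mathbb{N}$ with $f^n(x)=x$, where $f^n$ is the $n$-th iterate of $f$. *)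

theory Defs
  imports
    "HOL-Analysis.Analysis"
    "HOL-Computational_Algebra.Primes"
begin

(* Sequences are functions on nat and are indexed from 0: P n stands for p_(n+1), and
   z n stands for z_(n+1). *)

definition solenoid :: "(nat \<Rightarrow> nat) \<Rightarrow> (nat \<Rightarrow> complex) set" where
  "solenoid P = {z. (\<forall>n. z n \<in> sphere 0 1) \<and> (\<forall>n. z (Suc n) ^ P n = z n)}"

definition solenoid_topology :: "(nat \<Rightarrow> nat) \<Rightarrow> (nat \<Rightarrow> complex) topology" where
  "solenoid_topology P =
     subtopology (product_topology (\<lambda>_. top_of_set (sphere 0 1)) UNIV) (solenoid P)"

definition solenoid_identity :: "nat \<Rightarrow> complex" where
  "solenoid_identity = (\<lambda>_. 1)"

(* The formula does not depend on P; on solenoid P this is the limit mapping of that solenoid,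
   see limit_mapping_in_solenoid. *)
definition limit_mapping :: "nat \<Rightarrow> (nat \<Rightarrow> complex) \<Rightarrow> (nat \<Rightarrow> complex)" where
  "limit_mapping k z = (\<lambda>n. z n ^ k)"

definition cofinitely_avoided_primes :: "(nat \<Rightarrow> nat) \<Rightarrow> nat set" where
  "cofinitely_avoided_primes P = {q. prime q \<and> (\<exists>m. \<forall>n\<ge>m. q \<noteq> P n)}"

definition periodic_points :: "'a set \<Rightarrow> ('a \<Rightarrow> 'a) \<Rightarrow> 'a set" where
  "periodic_points X f = {x \<in> X. \<exists>n\<ge>1. (f ^^ n) x = x}"

lemma topspace_solenoid_topology: "topspace (solenoid_topology P) = solenoid P"
  by (auto simp: solenoid_topology_def solenoid_def)

lemma solenoid_identity_in_solenoid: "solenoid_identity \<in> solenoid P"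
  by (simp add: solenoid_identity_def solenoid_def)

lemma limit_mapping_in_solenoid: "z \<in> solenoid P \<Longrightarrow> limit_mapping k z \<in> solenoid P"
  by (simp add: limit_mapping_def solenoid_def norm_power)
     (metis power_commutes power_mult mult.commute)

end

theory Submission
  imports Defs "HOL-Number_Theory.Residues"
begin

text \<open>
  For a periodic point \<open>z\<close> there is a single \<open>M = k ^ m - 1\<close> with \<open>z n ^ M = 1\<close> for all \<open>n\<close>. If the
  product of \<open>S(P)\<close> divides \<open>k\<close>, every prime factor of \<open>M\<close> occurs infinitely often in \<open>P\<close>, and
  each such factor can be stripped off: if \<open>P j = q\<close>, then the \<open>j\<close>-th coordinate is a \<open>q\<close>-th power,
  so already the exponent \<open>M div q\<close> kills it and all coordinates below it.

  If \<open>q\<close> in \<open>S(P)\<close> does not divide \<open>k\<close>, approximate a late coordinate \<open>x n\<close> by a root of unity \<open>w\<close>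
  of order a power of \<open>q\<close>. Past \<open>n\<close> the primes \<open>P i\<close> are invertible modulo that order, so \<open>w\<close>
  extends to a point of the solenoid consisting of powers of \<open>w\<close>; it is periodic by Euler's theorem.
\<close>

lemma limit_mapping_funpow: "(limit_mapping k ^^ m) z = (\<lambda>n. z n ^ (k ^ m))"
  by (induction m) (auto simp: limit_mapping_def power_mult [symmetric] mult.commute)

lemma solenoid_coordinate_power:
  assumes "z \<in> solenoid P" "i \<le> n"
  shows "z i = z n ^ (\<Prod>t\<in>{i..<n}. P t)"
  using assms(2)
proof (induction n rule: dec_induct)
  case base
  then show ?case by simp
next
  case (step n)
  have "z (Suc n) ^ P n = z n"
    using assms(1) by (simp add: solenoid_def)
  then have "z n ^ (\<Prod>t\<in>{i..<n}. P t) = z (Suc n) ^ (P n * (\<Prod>t\<in>{i..<n}. P t))"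
    by (simp add: power_mult)
  then show ?case
    using step by (simp add: mult.commute)
qed

text \<open>Strong induction on \<open>M\<close>, removing one prime factor at a time. Each
  \<open>q\<close> has to recur at arbitrarily late positions because the smaller exponent must
  again kill every coordinate, however large its index.\<close>

lemma solenoid_torsion_trivial:
  assumes z: "z \<in> solenoid P"
    and "M \<ge> 1" and "\<And>n. z n ^ M = 1"
    and "\<And>q m. prime q \<Longrightarrow> q dvd M \<Longrightarrow> \<exists>j\<ge>m. P j = q"
  shows "z = solenoid_identity"
  using assms(2-)
proof (induction M rule: less_induct)
  case (less M)
  show ?case
  proof (cases "M = 1")
    case True
    then show ?thesis using less.prems(2) by (auto simp: solenoid_identity_def)
  next
    case False
    then obtain q where q: "prime q" "q dvd M"
      by (meson prime_factor_nat)
    then obtain M' where M': "M = q * M'" by (auto elim: dvdE)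
    have "M' < M" "M' \<ge> 1"
      using M' q less.prems(1) prime_gt_1_nat[of q] by (auto simp: Suc_le_eq)
    moreover have "z n ^ M' = 1" for n
    proof -
      obtain j where j: "j \<ge> n" "P j = q"
        using less.prems(3)[OF q] by blast
      have "z j = z (Suc j) ^ q" using z j by (auto simp: solenoid_def)
      then have "z j ^ M' = 1"
        using less.prems(2)[of "Suc j"] M' by (simp add: power_mult)
      then show ?thesis
        by (metis solenoid_coordinate_power[OF z j(1)] power_commutes power_mult mult.commute power_one)
    qed
    moreover have "\<exists>j\<ge>m. P j = p" if "prime p" "p dvd M'" for p m
      using less.prems(3)[of p] that M' by auto
    ultimately show ?thesis using less.IH[of M'] by blast
  qed
qed

lemma periodic_points_trivial:
  assumes "cofinitely_avoided_primes P \<noteq> {}" "finite (cofinitely_avoided_primes P)"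
    and "k \<ge> 1" and dvd: "\<Prod>(cofinitely_avoided_primes P) dvd k"
  shows "periodic_points (solenoid P) (limit_mapping k) = {solenoid_identity}"
proof -
  have q_dvd: "q dvd k" if "q \<in> cofinitely_avoided_primes P" for q
    using dvd_trans[OF dvd_prodI[OF assms(2) that, of "\<lambda>x. x"]] dvd by simp
  \<comment> \<open>Nonemptiness of \<open>S(P)\<close> excludes \<open>k = 1\<close>, for which
    every point would be periodic; \<open>k > 1\<close> makes the exponent \<open>k ^ m - 1\<close>
    positive.\<close>
  obtain q0 where "prime q0" "q0 dvd k"
    using assms(1) q_dvd by (auto simp: cofinitely_avoided_primes_def)
  then have k: "k > 1"
    using assms(3) prime_gt_1_nat[of q0] by (auto dest!: dvd_imp_le)
  have "z = solenoid_identity"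
    if periodic: "z \<in> periodic_points (solenoid P) (limit_mapping k)" for z
  proof -
    obtain m where z: "z \<in> solenoid P" and m: "m \<ge> 1" "\<And>n. z n ^ (k ^ m) = z n"
      using periodic by (auto simp: periodic_points_def limit_mapping_funpow fun_eq_iff)
    have km: "k ^ m > 1" using k m(1) by (intro one_less_power) auto
    show ?thesis
    proof (rule solenoid_torsion_trivial[OF z])
      show "k ^ m - 1 \<ge> 1" using km by simp
      show "z n ^ (k ^ m - 1) = 1" for n
      proof -
        have "norm (z n) = 1" using z by (simp add: solenoid_def)
        then have "z n \<noteq> 0" by auto
        moreover have "z n * z n ^ (k ^ m - 1) = z n"
          using m(2)[of n] k power_minus_mult[of "k ^ m" "z n"] by (simp add: mult.commute)
        ultimately show ?thesis by simp
      qed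
      show "\<exists>j\<ge>l. P j = q" if q: "prime q" "q dvd k ^ m - 1" for q l
      proof (rule ccontr)
        \<comment> \<open>A prime absent from position \<open>l\<close> on lies in
          \<open>S(P)\<close>, so it divides \<open>k\<close>; it would then divide both
          \<open>k ^ m\<close> and \<open>k ^ m - 1\<close>.\<close>
        assume "\<not> (\<exists>j\<ge>l. P j = q)"
        then have "q dvd k"
          using q by (intro q_dvd) (auto simp: cofinitely_avoided_primes_def)
        then have "q dvd k ^ m" using m(1) by (intro dvd_trans[OF _ dvd_power]) auto
        with q(2) km have "q dvd 1"
          by (metis dvd_diff_nat diff_diff_cancel less_imp_le_nat)
        with q(1) show False by simp
      qed
    qed
  qed
  moreover have "solenoid_identity \<in> periodic_points (solenoid P) (limit_mapping k)"
    using solenoid_identity_in_solenoid[of P]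
    by (auto simp: periodic_points_def limit_mapping_funpow solenoid_identity_def)
  ultimately show ?thesis by blast
qed

text \<open>The roots of unity of order dividing \<open>q ^ j\<close> are equally spaced with
  angular gap \<open>2 * pi / q ^ j\<close>, which falls below \<open>e\<close> for large
  \<open>j\<close>; a chord is no longer than its arc.\<close>

lemma roots_of_unity_dense:
  fixes q :: nat and x :: complex
  assumes q: "q > 1" and x: "norm x = 1" and e: "e > 0"
  obtains j w where "w ^ (q ^ j) = 1" "norm (w - x) < e"
proof -
  obtain t where t: "x = cis t"
    using x by (metis cis_Arg norm_zero sgn_eq scaleR_one div_by_1 of_real_1 zero_neq_one)
  obtain j where j: "2 * pi / e < real q ^ j"
    using real_arch_pow[of "real q"] q by auto
  define D where "D = real (q ^ j)"
  \<comment> \<open>Rounding the angle \<open>t\<close> down to the grid of multiples of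
    \<open>2 * pi / D\<close> gives the angle \<open>s\<close> of the wanted root.\<close>
  define f where "f = \<lfloor>t * D / (2 * pi)\<rfloor>"
  define s where "s = 2 * pi * f / D"
  have D: "D > 0" using q by (simp add: D_def)
  have lt: "\<bar>s - t\<bar> < e"
  proof -
    have "\<bar>of_int f - t * D / (2 * pi)\<bar> \<le> 1" unfolding f_def by linarith
    then have "\<bar>of_int f - t * D / (2 * pi)\<bar> * (2 * pi / D) \<le> 2 * pi / D"
      using D by (intro mult_left_le_one_le) auto
    moreover have "\<bar>s - t\<bar> = \<bar>of_int f - t * D / (2 * pi)\<bar> * (2 * pi / D)"
    proof -
      have "s - t = (of_int f - t * D / (2 * pi)) * (2 * pi / D)"
        using D by (simp add: s_def field_simps)
      then show ?thesis using D by (simp add: abs_mult)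
    qed
    moreover have "2 * pi / D < e"
      using j e D by (simp add: D_def field_simps)
    ultimately show ?thesis by linarith
  qed
  have "cis s ^ (q ^ j) = 1"
  proof -
    have "cis s ^ (q ^ j) = cis (2 * pi * f)"
      using D unfolding Complex.DeMoivre by (simp add: s_def D_def)
    also have "\<dots> = 1" by (rule cis_multiple_2pi) simp
    finally show ?thesis .
  qed
  moreover have "norm (cis s - x) < e"
  proof -
    have "cis s - cis t = cis t * (cis (s - t) - 1)"
      by (simp add: cis_mult algebra_simps)
    then have "norm (cis s - x) = norm (cis (s - t) - 1)"
      by (simp add: t norm_mult)
    also have "\<dots> = 2 * \<bar>sin ((s - t) / 2)\<bar>"
      using dist_exp_i_1[of "s - t"] by (simp add: cis_conv_exp)
    also have "\<dots> \<le> \<bar>s - t\<bar>"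
      using abs_sin_x_le_abs_x[of "(s - t) / 2"] by simp
    finally show ?thesis using lt by simp
  qed
  ultimately show ?thesis using that by blast
qed

text \<open>All coordinates are chosen in the finite cyclic group generated by \<open>w\<close>.
  There \<open>P t\<close>-th roots exist for \<open>t \<ge> n\<close>, and one Euler exponent for
  \<open>k\<close> fixes all coordinates at once.\<close>

lemma periodic_point_through_root_of_unity:
  fixes w :: complex
  assumes w: "w ^ Q = 1" and Q: "Q > 0"
    and "coprime k Q" and P: "\<And>t. t \<ge> n \<Longrightarrow> coprime (P t) Q"
  obtains y where "y \<in> periodic_points (solenoid P) (limit_mapping k)" "y n = w"
proof -
  have w_cong: "w ^ a = w ^ b" if "[a = b] (mod Q)" for a b
  proof -
    have "w ^ c = w ^ (c mod Q)" for c
      by (metis w power_add power_mult power_one mult_1 mult_div_mod_eq)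
    then show ?thesis using that by (metis cong_def)
  qed
  have "\<forall>t. \<exists>a. t \<ge> n \<longrightarrow> [P t * a = 1] (mod Q)"
    using P cong_solve_coprime_nat by (metis One_nat_def)
  then obtain a where a: "\<And>t. t \<ge> n \<Longrightarrow> [P t * a t = 1] (mod Q)"
    by metis
  \<comment> \<open>At least one of the two products is empty: below \<open>n\<close> powers of
    \<open>w\<close> are forced, above \<open>n\<close> roots are taken through the inverses
    \<open>a t\<close>, and \<open>d n = 1\<close>.\<close>
  define d where "d i = (\<Prod>t\<in>{i..<n}. P t) * (\<Prod>t\<in>{n..<i}. a t)" for i
  define y where "y i = w ^ d i" for i
  have norm_w: "norm w = 1"
    using w Q by (metis norm_one norm_power power_eq_1_iff norm_ge_zero neq0_conv)
  have "[d (Suc i) * P i = d i] (mod Q)" for i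
  proof (cases "i < n")
    case True
    then show ?thesis
      by (simp add: d_def prod.atLeast_Suc_lessThan mult.commute)
  next
    case False
    then have "d (Suc i) * P i = d i * (P i * a i)"
      by (simp add: d_def prod.atLeastLessThan_Suc mult_ac)
    moreover have "[d i * (P i * a i) = d i * 1] (mod Q)"
      using a[of i] False by (intro cong_scalar_left) simp
    ultimately show ?thesis by (metis mult_1_right)
  qed
  then have "y (Suc i) ^ P i = y i" for i
    unfolding y_def power_mult [symmetric] by (rule w_cong)
  then have "y \<in> solenoid P"
    by (simp add: solenoid_def y_def norm_power norm_w)
  moreover have "(limit_mapping k ^^ totient Q) y = y"
  proof
    fix i
    have "[d i * k ^ totient Q = d i * 1] (mod Q)"
      using assms(3) by (intro cong_scalar_left euler_theorem)
    then show "(limit_mapping k ^^ totient Q) y i = y i"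
      unfolding limit_mapping_funpow y_def power_mult [symmetric] by (simp add: w_cong)
  qed
  moreover have "totient Q \<ge> 1" using Q by (simp add: Suc_le_eq)
  ultimately have "y \<in> periodic_points (solenoid P) (limit_mapping k)"
    unfolding periodic_points_def by blast
  moreover have "y n = w" by (simp add: y_def d_def)
  ultimately show ?thesis using that by blast
qed

text \<open>Closeness at the single coordinate \<open>n\<close> controls all earlier ones, since
  these are powers of it and \<open>d\<close>-th powers expand distances on the unit circle by a
  factor of at most \<open>d\<close>.\<close>

lemma periodic_points_approximate:
  assumes P: "\<And>n. prime (P n)" and q: "q \<in> cofinitely_avoided_primes P" "\<not> q dvd k"
    and x: "x \<in> solenoid P" and e: "e > 0"
  obtains y where "y \<in> periodic_points (solenoid P) (limit_mapping k)"
    "\<And>i. i \<le> l \<Longrightarrow> norm (y i - x i) < e"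
proof -
  obtain N where "prime q" and N: "\<And>n. n \<ge> N \<Longrightarrow> q \<noteq> P n"
    using q(1) by (auto simp: cofinitely_avoided_primes_def)
  \<comment> \<open>From \<open>n\<close> on, \<open>q\<close> no longer occurs in \<open>P\<close>,
    so those primes are coprime to \<open>q ^ j\<close>; \<open>E\<close> bounds the exponents
    leading from coordinate \<open>n\<close> down to any earlier one.\<close>
  define n where "n = max N l"
  define E where "E = (\<Prod>t<n. P t)"
  have E: "E > 0" using P by (simp add: E_def prime_gt_0_nat)
  have nx: "norm (x i) = 1" for i using x by (simp add: solenoid_def)
  obtain j w where w: "w ^ (q ^ j) = 1" "norm (w - x n) < e / E"
    using roots_of_unity_dense[OF prime_gt_1_nat[OF \<open>prime q\<close>] nx, of "e / E" n] e E
    by (metis divide_pos_pos of_nat_0_less_iff)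
  have "coprime k (q ^ j)"
    using q(2) \<open>prime q\<close> by (metis coprime_commute coprime_power_right_iff prime_imp_coprime)
  moreover have "coprime (P t) (q ^ j)" if "t \<ge> n" for t
    using N[of t] that P[of t] \<open>prime q\<close> by (simp add: n_def primes_coprime)
  ultimately obtain y where y: "y \<in> periodic_points (solenoid P) (limit_mapping k)" "y n = w"
    using periodic_point_through_root_of_unity[OF w(1)] \<open>prime q\<close>
    by (metis prime_gt_0_nat zero_less_power)
  then have ys: "y \<in> solenoid P" by (simp add: periodic_points_def)
  have "norm (y i - x i) < e" if "i \<le> l" for i
  proof -
    define d where "d = (\<Prod>t\<in>{i..<n}. P t)"
    have "i \<le> n" using that by (simp add: n_def)
    then have "y i = y n ^ d" "x i = x n ^ d"
      unfolding d_def using solenoid_coordinate_power ys x by blast+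
    then have "norm (y i - x i) \<le> d * norm (w - x n)"
      using norm_power_diff[of w "x n" d] ys nx y(2) by (auto simp: solenoid_def)
    also have "d \<le> E"
      using E unfolding d_def E_def by (intro dvd_imp_le prod_dvd_prod_subset) auto
    then have "d * norm (w - x n) \<le> E * norm (w - x n)"
      by (intro mult_right_mono) auto
    also have "\<dots> < e" using w(2) E by (simp add: field_simps)
    finally show ?thesis .
  qed
  with y(1) show ?thesis using that by blast
qed

lemma limitin_solenoid_topology:
  assumes "\<And>j. y j \<in> solenoid P" "x \<in> solenoid P" "\<And>i. (\<lambda>j. y j i) \<longlonglongrightarrow> x i"
  shows "limitin (solenoid_topology P) y x sequentially"
  using assms
  by (simp add: solenoid_topology_def limitin_subtopology limitin_componentwise solenoid_def PiE_UNIV_domain Pi_iff)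

lemma periodic_points_dense:
  assumes "\<And>n. prime (P n)" and "q \<in> cofinitely_avoided_primes P" "\<not> q dvd k"
  shows "solenoid_topology P closure_of periodic_points (solenoid P) (limit_mapping k)
           = topspace (solenoid_topology P)" (is "_ closure_of ?S = _")
proof
  show "topspace (solenoid_topology P) \<subseteq> solenoid_topology P closure_of ?S"
  proof
    fix x assume "x \<in> topspace (solenoid_topology P)"
    then have x: "x \<in> solenoid P" by (simp add: topspace_solenoid_topology)
    \<comment> \<open>The index \<open>j\<close> governs both the range of coordinates and the
      error, so a fixed coordinate \<open>i\<close> is controlled from \<open>j = i\<close> on,
      which suffices for coordinatewise convergence.\<close>
    have "\<exists>y\<in>?S. \<forall>i\<le>j. norm (y i - x i) < inverse (Suc j)" for j
      using periodic_points_approximate[OF assms x, of "inverse (Suc j)" j]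
      by (metis inverse_positive_iff_positive of_nat_0_less_iff zero_less_Suc)
    then obtain y where yS: "\<And>j. y j \<in> ?S"
      and y: "\<And>i j. i \<le> j \<Longrightarrow> norm (y j i - x i) < inverse (Suc j)"
      by metis
    have "(\<lambda>j. y j i) \<longlonglongrightarrow> x i" for i
    proof -
      have "(\<lambda>j. y j i - x i) \<longlonglongrightarrow> 0"
        by (rule Lim_null_comparison[OF _ LIMSEQ_inverse_real_of_nat])
          (use y in \<open>auto intro!: eventually_sequentiallyI[of i] less_imp_le\<close>)
      then show ?thesis by (simp add: LIM_zero_iff)
    qed
    then have "limitin (solenoid_topology P) y x sequentially"
      using x yS by (intro limitin_solenoid_topology) (auto simp: periodic_points_def)
    then show "x \<in> solenoid_topology P closure_of ?S"
      unfolding in_closure_of limitin_def eventually_sequentially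
      by (metis order_refl yS)
  qed
qed (rule closure_of_subset_topspace)

theorem proposition7:
  fixes P :: "nat \<Rightarrow> nat" and k :: nat
  assumes "\<And>n. prime (P n)"
    and "cofinitely_avoided_primes P \<noteq> {}"
    and "finite (cofinitely_avoided_primes P)"
    and "k \<ge> 1"
  shows "(\<Prod>(cofinitely_avoided_primes P) dvd k \<longrightarrow>
            periodic_points (solenoid P) (limit_mapping k) = {solenoid_identity}) \<and>
         ((\<exists>q\<in>cofinitely_avoided_primes P. \<not> q dvd k) \<longrightarrow>
            solenoid_topology P closure_of periodic_points (solenoid P) (limit_mapping k)
              = topspace (solenoid_topology P))"
proof (intro conjI impI)
  show "solenoid_topology P closure_of periodic_points (solenoid P) (limit_mapping k)
          = topspace (solenoid_topology P)"
    if "\<exists>q\<in>cofinitely_avoided_primes P. \<not> q dvd k"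
    using that periodic_points_dense assms(1) by blast
qed (rule periodic_points_trivial[OF assms(2-4)])

end
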